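(* Let $A\in\mathbb{R}^{m\times n}$, $\bar{x}\in\mathbb{R}^n$, $\bar{b}=A\bar{x}\in\mathbb{R}^m$ and $\alpha>0$. For perturbations $E_A\in\mathbb{R}^{m\times n}$, $E_{A^T}\in\mathbb{R}^{n\times m}$, $e\in\mathbb{R}^m$ put $$\widetilde{A}=A+E_A,\qquad \widehat{A}^{\,T}=A^T+E_{A^T},\qquad b=\bar{b}+e .$$ Let $\tilde{x}_\alpha$ be the solution of the regularized unmatched normal equations $(\widehat{A}^{\,T}\widetilde{A}+\alpha I)\,x=\widehat{A}^{\,T}b$, and let $\bar{x}_\alpha=(A^TA+\alpha I)^{-1}A^T\bar{b}$. Then the following first-order error bounds, obtained by omitting higher-order terms, hold: $$\|\tilde{x}_\alpha-\bar{x}_\alpha\|\;\lesssim\;\frac{1}{2\sqrt{\alpha}}\,\|e\|+\frac{1}{2\sqrt{\alpha}}\,\|E_A\,\bar{x}_\alpha\|+\frac{1}{\alpha}\,\|E_{A^T}\,(\bar{b}-A\,\bar{x}_\alpha)\| ,$$ and, if $\bar{x}_\alpha\neq 0$, $$\frac{\|\tilde{x}_\alpha-\bar{x}_\alpha\|}{\|\bar{x}_\alpha\|}\;\lesssim\;\frac{\|A\|}{2\sqrt{\alpha}}\,\frac{\|e\|}{\|A\,\bar{x}_\alpha\|}+\frac{\|A\|}{2\sqrt{\alpha}}\,\frac{\|E_A\|}{\|A\|}+\frac{\|A\|^2}{\alpha}\,\frac{\|E_{A^T}\|}{\|A\|}\,\frac{\|\bar{b}-A\,\bar{x}_\alpha\|}{\|A\,\bar{x}_\alpha\|}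 .$$
   Context: $\|\cdot\|$ denotes the vector and matrix 2-norm (spectral norm for matrices). $\widehat{A}^{\,T}$ is just a name for the perturbed ("unmatched") transpose; it is not assumed to be the transpose of $\widetilde{A}$. The symbol $\lesssim$ means inequality up to terms of higher than first order in the perturbations: with $A$, $\bar{b}$, $\alpha$ fixed, "left $\lesssim$ right" means left $\le$ right $+\,O(\eta^2)$ as $\eta:=\|E_A\|+\|E_{A^T}\|+\|e\|\to 0$. For $\eta$ small enough the matrix $\widehat{A}^{\,T}\widetilde{A}+\alpha I$ is nonsingular, so $\tilde{x}_\alpha$ is well defined. *)

theory Defs
  imports "HOL-Analysis.Analysis" "HOL-Library.Landau_Symbols"
begin

text \<open>The type class norm on \<^typ>\<open>real^'n^'m\<close> is the Frobenius norm, so the matrix 2-norm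
  has to be taken as the operator norm.\<close>

definition spectral_norm :: "real^'n^'m \<Rightarrow> real" where
  "spectral_norm A = onorm (\<lambda>v. A *v v)"

definition pert_size :: "(real^'n^'m) \<times> (real^'m^'n) \<times> (real^'m) \<Rightarrow> real" where
  "pert_size = (\<lambda>(E, F, e). spectral_norm E + spectral_norm F + norm e)"

definition small_pert :: "((real^'n^'m) \<times> (real^'m^'n) \<times> (real^'m)) filter" where
  "small_pert = filtercomap pert_size (nhds 0)"

text \<open>\<open>f\<close> is at most \<open>g\<close> up to terms of higher than first order in the perturbations. The remainder
  bound is uniform over all perturbations of a given size.\<close>

definition first_order_le ::
  "((real^'n^'m) \<times> (real^'m^'n) \<times> (real^'m) \<Rightarrow> real) \<Rightarrow>
   ((real^'n^'m) \<times> (real^'m^'n) \<times> (real^'m) \<Rightarrow> real) \<Rightarrow> bool"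
  (infix "\<lesssim>" 50) where
  "f \<lesssim> g \<longleftrightarrow>
     (\<exists>h \<in> O[small_pert](\<lambda>p. (pert_size p)\<^sup>2). \<forall>\<^sub>F p in small_pert. f p \<le> g p + h p)"

definition unmatched_matrix :: "real \<Rightarrow> real^'n^'m \<Rightarrow> real^'m^'n \<Rightarrow> real^'n^'n" where
  "unmatched_matrix \<alpha> A B = B ** A + \<alpha> *\<^sub>R mat 1"

text \<open>\<open>B\<close> plays the role of the transpose of \<open>A\<close> but is independent of it. The description is
  meaningful whenever \<open>unmatched_matrix \<alpha> A B\<close> is invertible.\<close>

definition unmatched_solution ::
  "real \<Rightarrow> real^'n^'m \<Rightarrow> real^'m^'n \<Rightarrow> real^'m \<Rightarrow> real^'n" where
  "unmatched_solution \<alpha> A B b = (THE x. unmatched_matrix \<alpha> A B *v x = B *v b)"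

end

theory Submission
  imports Defs
begin

text \<open>Write \<open>M = A\<^sup>T A + \<alpha> I\<close>, \<open>r = bbar - A xbar\<^sub>\<alpha>\<close> for the residual of the unperturbed solution, and
  \<open>d\<close> for the error of the perturbed solution. Subtracting \<open>\<alpha> xbar\<^sub>\<alpha> = A\<^sup>T r\<close> from the perturbed
  equations gives, exactly,
  \<open>M d = A\<^sup>T (e - E xbar\<^sub>\<alpha>) + F r + F (e - E xbar\<^sub>\<alpha>) - (F A + A\<^sup>T E + F E) d\<close>.
  The first two terms are linear in the perturbations. The third is quadratic, and so is the last
  one as soon as \<open>d\<close> is known to be of first order. The bounds then come from
  \<open>\<parallel>M\<^sup>-\<^sup>1 A\<^sup>T\<parallel> \<le> 1 / (2 \<surd>\<alpha>)\<close> and \<open>\<parallel>M\<^sup>-\<^sup>1\<parallel> \<le> 1 / \<alpha>\<close> (\<open>regularized_solution_norm_le\<close>,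
  \<open>regularized_inverse_norm_le\<close>), both of which follow from the energy identity
  \<open>z \<bullet> M z = \<parallel>A z\<parallel>\<^sup>2 + \<alpha> \<parallel>z\<parallel>\<^sup>2\<close> without a singular value decomposition.

  That \<open>d\<close> is of first order, and that the perturbed matrix is invertible, have the same cause:
  for small perturbations the matrix changes by at most \<open>\<alpha> / 2\<close> in norm, so the term
  \<open>(F A + A\<^sup>T E + F E) d\<close> can be absorbed at the cost of a factor \<open>2\<close>. Inserting the resulting crude
  estimate of \<open>d\<close> once more gives the sharp constants (\<open>perturbed_solution_error\<close>).

  The relative bound is the absolute one divided by \<open>\<parallel>xbar\<^sub>\<alpha>\<parallel>\<close>, since
  \<open>\<parallel>A xbar\<^sub>\<alpha>\<parallel> \<le> \<parallel>A\<parallel> \<parallel>xbar\<^sub>\<alpha>\<parallel>\<close>. Its denominators are nonzero because \<open>xbar\<^sub>\<alpha>\<close> lies in the range of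
  \<open>A\<^sup>T\<close>, which meets the kernel of \<open>A\<close> only in \<open>0\<close>.\<close>

section \<open>Spectral norm and first-order inequalities\<close>

lemma norm_matrix_vector_le_spectral_norm:
  fixes A :: "real^'n^'m"
  shows "norm (A *v v) \<le> spectral_norm A * norm v"
  unfolding spectral_norm_def by (rule onorm) simp

lemma spectral_norm_nonneg: "0 \<le> spectral_norm (A :: real^'n^'m)"
  unfolding spectral_norm_def by (rule onorm_pos_le) simp

lemma pert_size_components:
  fixes E :: "real^'n^'m" and F :: "real^'m^'n" and e :: "real^'m"
  shows "spectral_norm E \<le> pert_size (E, F, e)" "spectral_norm F \<le> pert_size (E, F, e)"
    "norm e \<le> pert_size (E, F, e)" "0 \<le> pert_size (E, F, e)"
  using spectral_norm_nonneg[of E] spectral_norm_nonneg[of F] by (auto simp: pert_size_def)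

lemma norm_pert_vector_le:
  fixes E :: "real^'n^'m" and F :: "real^'m^'n" and e :: "real^'m"
  shows "norm (E *v v) \<le> pert_size (E, F, e) * norm v"
    and "norm (F *v w) \<le> pert_size (E, F, e) * norm w"
  using norm_matrix_vector_le_spectral_norm[of E v] norm_matrix_vector_le_spectral_norm[of F w]
    mult_right_mono[OF pert_size_components(1)[of E F e], of "norm v"]
    mult_right_mono[OF pert_size_components(2)[of F E e], of "norm w"]
  by simp_all

lemma eventually_small_pertI:
  fixes P :: "(real^'n^'m) \<times> (real^'m^'n) \<times> (real^'m) \<Rightarrow> bool"
  assumes "\<delta> > 0" "\<And>p. pert_size p < \<delta> \<Longrightarrow> P p"
  shows "\<forall>\<^sub>F p in small_pert. P p"
  unfolding small_pert_def eventually_filtercomap eventually_nhds_metric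
proof (intro exI conjI)
  show "\<forall>y. dist y 0 < \<delta> \<longrightarrow> y < \<delta>" by (auto simp: dist_real_def)
qed (use assms in auto)

lemma first_order_leI:
  fixes f g :: "(real^'n^'m) \<times> (real^'m^'n) \<times> (real^'m) \<Rightarrow> real"
  assumes "\<delta> > 0" "\<And>p. pert_size p < \<delta> \<Longrightarrow> f p \<le> g p + C * (pert_size p)\<^sup>2"
  shows "f \<lesssim> g"
  unfolding first_order_le_def
proof (intro bexI)
  show "\<forall>\<^sub>F p in small_pert. f p \<le> g p + C * (pert_size p)\<^sup>2"
    using assms by (rule eventually_small_pertI)
qed simp

lemma unmatched_matrix_mult_vec:
  "unmatched_matrix \<alpha> A B *v v = B *v (A *v v) + \<alpha> *\<^sub>R v"
  by (simp add: unmatched_matrix_def matrix_vector_mult_add_rdistrib matrix_vector_mul_assoc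
      scaleR_matrix_vector_assoc[symmetric])

lemma unmatched_solution_eq:
  assumes "invertible (unmatched_matrix \<alpha> A B)"
  shows "unmatched_matrix \<alpha> A B *v unmatched_solution \<alpha> A B b = B *v b"
  unfolding unmatched_solution_def
proof (rule theI')
  let ?M = "unmatched_matrix \<alpha> A B"
  have "bij ((*v) ?M)" using assms by (simp add: invertible_eq_bij)
  then show "\<exists>!x. ?M *v x = B *v b" by (metis bij_pointE)
qed

lemma matrix_inv_right:
  assumes "invertible A"
  shows "A ** matrix_inv A = mat 1"
  using someI_ex[OF assms[unfolded invertible_def]] by (simp add: matrix_inv_def)

lemma invertible_if_kernel_trivial:
  fixes M :: "real^'n^'n"
  assumes "\<And>v. M *v v = 0 \<Longrightarrow> v = 0"
  shows "invertible M"
  using assms by (simp add: invertible_left_inverse matrix_left_invertible_ker)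

section \<open>Tikhonov-regularized normal equations\<close>

lemma regularized_energy:
  fixes A :: "real^'n^'m"
  shows "z \<bullet> (unmatched_matrix \<alpha> A (transpose A) *v z) = (norm (A *v z))\<^sup>2 + \<alpha> * (norm z)\<^sup>2"
  by (simp add: unmatched_matrix_mult_vec inner_add_right dot_lmul_matrix[symmetric]
      power2_norm_eq_inner inner_commute)

lemma regularized_inverse_norm_le:
  fixes A :: "real^'n^'m"
  assumes "\<alpha> > 0"
  shows "norm z \<le> norm (unmatched_matrix \<alpha> A (transpose A) *v z) / \<alpha>"
proof (cases "z = 0")
  case False
  let ?u = "unmatched_matrix \<alpha> A (transpose A) *v z"
  have "\<alpha> * (norm z)\<^sup>2 \<le> z \<bullet> ?u" by (simp add: regularized_energy)
  also have "\<dots> \<le> norm z * norm ?u" by (rule norm_cauchy_schwarz)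
  finally have "norm z * (\<alpha> * norm z) \<le> norm z * norm ?u"
    by (simp add: power2_eq_square algebra_simps)
  then show ?thesis using False assms by (simp add: field_simps)
qed (use assms in simp)

text \<open>With \<open>t = \<parallel>A z\<parallel>\<close> the energy identity gives \<open>\<alpha> \<parallel>z\<parallel>\<^sup>2 \<le> \<parallel>w\<parallel> t - t\<^sup>2\<close>, and the right-hand side is
  at most \<open>\<parallel>w\<parallel>\<^sup>2 / 4\<close> whatever \<open>t\<close> is; this replaces the usual maximization of
  \<open>\<sigma> / (\<sigma>\<^sup>2 + \<alpha>)\<close> over the singular values.\<close>

lemma regularized_solution_norm_le:
  fixes A :: "real^'n^'m"
  assumes "\<alpha> > 0" "unmatched_matrix \<alpha> A (transpose A) *v z = transpose A *v w"
  shows "norm z \<le> 1 / (2 * sqrt \<alpha>) * norm w"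
proof -
  let ?t = "norm (A *v z)"
  have "?t\<^sup>2 + \<alpha> * (norm z)\<^sup>2 = z \<bullet> (transpose A *v w)"
    using regularized_energy[of z \<alpha> A] assms(2) by simp
  also have "\<dots> = (A *v z) \<bullet> w"
    by (metis dot_lmul_matrix inner_commute transpose_matrix_vector)
  also have "\<dots> \<le> ?t * norm w" by (rule norm_cauchy_schwarz)
  finally have "4 * (\<alpha> * (norm z)\<^sup>2) \<le> (norm w)\<^sup>2"
    using zero_le_power2[of "norm w - 2 * ?t"] by (simp add: power2_eq_square algebra_simps)
  then have "(2 * sqrt \<alpha> * norm z)\<^sup>2 \<le> (norm w)\<^sup>2"
    using assms(1) by (simp add: power_mult_distrib)
  then have "2 * sqrt \<alpha> * norm z \<le> norm w" by (rule power2_le_imp_le) simp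
  then show ?thesis using assms(1) by (simp add: field_simps)
qed

lemma invertible_regularized:
  fixes A :: "real^'n^'m"
  assumes "\<alpha> > 0"
  shows "invertible (unmatched_matrix \<alpha> A (transpose A))"
proof (rule invertible_if_kernel_trivial)
  fix v assume "unmatched_matrix \<alpha> A (transpose A) *v v = 0"
  then show "v = 0" using regularized_inverse_norm_le[OF assms, of v A] by simp
qed

text \<open>\<open>x\<close> lies in the range of \<open>A\<^sup>T\<close>, the orthogonal complement of the kernel of \<open>A\<close>; the energy
  identity expresses this orthogonality directly.\<close>

lemma regularized_solution_in_kernel:
  fixes A :: "real^'n^'m"
  assumes "\<alpha> > 0" "unmatched_matrix \<alpha> A (transpose A) *v x = transpose A *v b" "A *v x = 0"
  shows "x = 0"
proof -
  have "\<alpha> * (norm x)\<^sup>2 = x \<bullet> (transpose A *v b)"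
    using regularized_energy[of x \<alpha> A] assms(2,3) by simp
  also have "\<dots> = (A *v x) \<bullet> b" by (metis dot_lmul_matrix inner_commute transpose_matrix_vector)
  finally show ?thesis using assms(1,3) by simp
qed

section \<open>Perturbation of the normal equations\<close>

text \<open>The matrix changes by \<open>F A + A\<^sup>T E + F E\<close>. The three summands of the constant belong to these
  three terms; \<open>\<eta> \<le> 1\<close> turns the quadratic bound of \<open>F E\<close> into a linear one.\<close>

lemma unmatched_matrix_perturbation:
  fixes A E :: "real^'n^'m" and F :: "real^'m^'n" and e :: "real^'m"
  defines "\<eta> \<equiv> pert_size (E, F, e)"
  assumes "\<eta> \<le> 1"
  shows "norm (unmatched_matrix \<alpha> (A + E) (transpose A + F) *v v
      - unmatched_matrix \<alpha> A (transpose A) *v v)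
    \<le> \<eta> * (spectral_norm A + spectral_norm (transpose A) + 1) * norm v"
proof -
  let ?a = "spectral_norm A" and ?t = "spectral_norm (transpose A)"
  have \<eta>0: "0 \<le> \<eta>" unfolding \<eta>_def by (rule pert_size_components)
  note E = norm_pert_vector_le(1)[where E=E and F=F and e=e, folded \<eta>_def]
  note F = norm_pert_vector_le(2)[where E=E and F=F and e=e, folded \<eta>_def]
  have diff: "unmatched_matrix \<alpha> (A + E) (transpose A + F) *v v
      - unmatched_matrix \<alpha> A (transpose A) *v v
    = F *v (A *v v) + transpose A *v (E *v v) + F *v (E *v v)"
    by (simp add: unmatched_matrix_mult_vec matrix_vector_mult_add_rdistrib
        matrix_vector_right_distrib)
  have "norm (F *v (A *v v)) \<le> \<eta> * (?a * norm v)"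
    using F[of "A *v v"] mult_left_mono[OF norm_matrix_vector_le_spectral_norm[of A v] \<eta>0] by simp
  moreover have "norm (transpose A *v (E *v v)) \<le> ?t * (\<eta> * norm v)"
    using norm_matrix_vector_le_spectral_norm[of "transpose A" "E *v v"]
      mult_left_mono[OF E[of v] spectral_norm_nonneg[of "transpose A"]] by simp
  moreover have "norm (F *v (E *v v)) \<le> \<eta> * norm v"
  proof -
    have "norm (E *v v) \<le> norm v"
      using E[of v] mult_right_mono[OF assms(2), of "norm v"] by simp
    then show ?thesis using F[of "E *v v"] mult_left_mono[OF _ \<eta>0] by fastforce
  qed
  ultimately show ?thesis unfolding diff
    using norm_triangle_ineq[of "F *v (A *v v) + transpose A *v (E *v v)" "F *v (E *v v)"]
      norm_triangle_ineq[of "F *v (A *v v)" "transpose A *v (E *v v)"]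
    by (simp add: algebra_simps)
qed

text \<open>\<open>M\<close> stretches every vector by a factor of at least \<open>\<alpha>\<close>, so a change of at most \<open>\<alpha> / 2\<close> cannot
  send a nonzero vector to \<open>0\<close>.\<close>

lemma invertible_perturbed:
  fixes A E :: "real^'n^'m" and F :: "real^'m^'n" and e :: "real^'m"
  defines "\<eta> \<equiv> pert_size (E, F, e)"
  assumes "\<alpha> > 0" "\<eta> \<le> 1"
    and "\<eta> * (spectral_norm A + spectral_norm (transpose A) + 1) \<le> \<alpha> / 2"
  shows "invertible (unmatched_matrix \<alpha> (A + E) (transpose A + F))"
proof (rule invertible_if_kernel_trivial)
  fix v assume "unmatched_matrix \<alpha> (A + E) (transpose A + F) *v v = 0"
  then have "norm (unmatched_matrix \<alpha> A (transpose A) *v v) \<le> \<alpha> / 2 * norm v"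
    using unmatched_matrix_perturbation[of E F e \<alpha> A v] mult_right_mono[OF assms(4), of "norm v"]
      assms(3) by (simp add: \<eta>_def)
  then have "norm v \<le> (\<alpha> / 2 * norm v) / \<alpha>"
    using regularized_inverse_norm_le[OF assms(2), of v A] divide_right_mono[of _ _ \<alpha>] assms(2)
    by (meson less_imp_le order_trans)
  then show "v = 0" using assms(2) by simp
qed

text \<open>With \<open>d = x - x\<^sub>0\<close>, the vector \<open>M d\<close> splits into a part in the range of \<open>A\<^sup>T\<close>, which profits from
  the better constant \<open>1 / (2 \<surd>\<alpha>)\<close>, the part \<open>F r\<close>, and a remainder \<open>q\<close> that is bounded by a multiple
  of \<open>\<eta>\<^sup>2 + \<eta> \<parallel>d\<parallel>\<close>. This bound of \<open>q\<close> is used twice: crudely, to get \<open>\<parallel>d\<parallel> \<le> D \<eta>\<close>, and then with that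
  estimate inserted, which makes \<open>q\<close> quadratic. The constant in front of \<open>\<eta>\<^sup>2\<close> depends only on the
  unperturbed data, as a first-order inequality requires.\<close>

lemma perturbed_solution_error:
  fixes A E :: "real^'n^'m" and F :: "real^'m^'n" and e b :: "real^'m" and x\<^sub>0 x :: "real^'n" and \<alpha> :: real
  defines "\<eta> \<equiv> pert_size (E, F, e)"
    and "r \<equiv> b - A *v x\<^sub>0"
    and "K \<equiv> spectral_norm A + spectral_norm (transpose A) + 1"
  defines "D \<equiv> 2 * ((1 + norm x\<^sub>0) / (2 * sqrt \<alpha>) + norm r / \<alpha> + (1 + norm x\<^sub>0) / \<alpha>)"
  assumes \<alpha>: "\<alpha> > 0" and \<eta>1: "\<eta> \<le> 1" and small: "\<eta> * K \<le> \<alpha> / 2"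
    and x\<^sub>0: "unmatched_matrix \<alpha> A (transpose A) *v x\<^sub>0 = transpose A *v b"
    and x: "unmatched_matrix \<alpha> (A + E) (transpose A + F) *v x = (transpose A + F) *v (b + e)"
  shows "norm (x - x\<^sub>0) \<le> 1 / (2 * sqrt \<alpha>) * norm e + 1 / (2 * sqrt \<alpha>) * norm (E *v x\<^sub>0)
      + 1 / \<alpha> * norm (F *v r) + (1 + norm x\<^sub>0 + K * D) / \<alpha> * \<eta>\<^sup>2"
proof -
  let ?M = "unmatched_matrix \<alpha> A (transpose A)"
  let ?P = "unmatched_matrix \<alpha> (A + E) (transpose A + F)"
  define d where "d = x - x\<^sub>0"
  define w where "w = e - E *v x\<^sub>0"
  (* ?P *v d - ?M *v d is the (F A + A\<^sup>T E + F E) d of the exact error equation. *)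
  define q where "q = F *v w - (?P *v d - ?M *v d)"
  define c where "c = 1 / (2 * sqrt \<alpha>)"
  define lin where "lin = c * norm e + c * norm (E *v x\<^sub>0) + 1 / \<alpha> * norm (F *v r)"
  have \<eta>0: "0 \<le> \<eta>" unfolding \<eta>_def by (rule pert_size_components)
  have c0: "0 \<le> c" using \<alpha> by (simp add: c_def)
  have e\<eta>: "norm e \<le> \<eta>" unfolding \<eta>_def by (rule pert_size_components)
  note E = norm_pert_vector_le(1)[where E=E and F=F and e=e, folded \<eta>_def]
  note F = norm_pert_vector_le(2)[where E=E and F=F and e=e, folded \<eta>_def]
  have w_le: "norm w \<le> norm e + norm (E *v x\<^sub>0)"
    unfolding w_def by (rule norm_triangle_ineq4)
  have w_\<eta>: "norm w \<le> \<eta> * (1 + norm x\<^sub>0)"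
    using w_le e\<eta> E[of x\<^sub>0] by (simp add: algebra_simps)

  have x\<^sub>0_res: "\<alpha> *\<^sub>R x\<^sub>0 = transpose A *v r"
    using x\<^sub>0 by (simp add: r_def unmatched_matrix_mult_vec matrix_vector_mult_diff_distrib
        algebra_simps)
  have "?P *v d = (transpose A + F) *v (b + e) - ?P *v x\<^sub>0"
    by (simp add: d_def matrix_vector_mult_diff_distrib x)
  also have "\<dots> = (transpose A + F) *v (r + w) - \<alpha> *\<^sub>R x\<^sub>0"
    by (simp add: r_def w_def unmatched_matrix_mult_vec matrix_vector_mult_add_rdistrib
        matrix_vector_right_distrib matrix_vector_mult_diff_distrib algebra_simps)
  also have "\<dots> = transpose A *v w + F *v r + F *v w"
    unfolding x\<^sub>0_res
    by (simp add: matrix_vector_mult_add_rdistrib matrix_vector_right_distrib)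
  finally have Md: "?M *v d = transpose A *v w + F *v r + q"
    by (simp add: q_def algebra_simps)

  have "surj ((*v) ?M)"
    using invertible_regularized[OF \<alpha>, of A] by (simp add: invertible_eq_bij bij_is_surj)
  then obtain z where z: "?M *v z = transpose A *v w" by (metis surjD)
  have "norm z \<le> c * norm w"
    unfolding c_def by (rule regularized_solution_norm_le[OF \<alpha> z])
  also have "\<dots> \<le> c * norm e + c * norm (E *v x\<^sub>0)"
    using mult_left_mono[OF w_le c0] by (simp add: algebra_simps)
  finally have z_le: "norm z \<le> c * norm e + c * norm (E *v x\<^sub>0)" .
  have "?M *v (d - z) = F *v r + q" by (simp add: matrix_vector_mult_diff_distrib Md z)
  then have "norm (d - z) \<le> norm (F *v r + q) / \<alpha>"
    using regularized_inverse_norm_le[OF \<alpha>, of "d - z" A] by simp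
  also have "\<dots> \<le> (norm (F *v r) + norm q) / \<alpha>"
    using \<alpha> by (intro divide_right_mono norm_triangle_ineq) simp
  finally have d_lin: "norm d \<le> lin + norm q / \<alpha>"
    using z_le norm_triangle_ineq[of "d - z" z] by (simp add: lin_def add_divide_distrib)

  have "norm (F *v w) \<le> \<eta> * (\<eta> * (1 + norm x\<^sub>0))"
    using F[of w] mult_left_mono[OF w_\<eta> \<eta>0] by simp
  then have q_le: "norm q \<le> \<eta>\<^sup>2 * (1 + norm x\<^sub>0) + \<eta> * K * norm d"
    using norm_triangle_ineq4[of "F *v w" "?P *v d - ?M *v d"]
      unmatched_matrix_perturbation[of E F e \<alpha> A d] \<eta>1
    by (simp add: q_def \<eta>_def K_def power2_eq_square mult.assoc)

  (* A priori bound: the d-term of q is at most half of d and is absorbed on the left. *)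
  define X Y where "X = \<eta> * ((1 + norm x\<^sub>0) * c + norm r / \<alpha>)" and "Y = \<eta> * (1 + norm x\<^sub>0) / \<alpha>"
  have "\<eta> * K * norm d \<le> \<alpha> / 2 * norm d" by (rule mult_right_mono[OF small]) simp
  moreover have "\<eta>\<^sup>2 * (1 + norm x\<^sub>0) \<le> \<eta> * (1 + norm x\<^sub>0)"
    using \<eta>0 \<eta>1 by (intro mult_right_mono) (simp_all add: power2_eq_square mult_left_le)
  ultimately have "norm q \<le> \<eta> * (1 + norm x\<^sub>0) + \<alpha> / 2 * norm d" using q_le by linarith
  then have "norm q / \<alpha> \<le> Y + norm d / 2"
    using \<alpha> by (simp add: Y_def field_simps)
  moreover have "lin \<le> X"
  proof -
    have "1 / \<alpha> * norm (F *v r) \<le> 1 / \<alpha> * (\<eta> * norm r)"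
      using \<alpha> by (intro mult_left_mono F) simp
    then show ?thesis
      using mult_left_mono[OF e\<eta> c0] mult_left_mono[OF E[of x\<^sub>0] c0]
      by (simp add: lin_def X_def algebra_simps)
  qed
  ultimately have "norm d \<le> X + (Y + norm d / 2)"
    using d_lin by (meson add_mono order_trans)
  then have "norm d \<le> 2 * (X + Y)" by argo
  moreover have "D * \<eta> = 2 * (X + Y)"
    by (simp add: D_def X_def Y_def c_def algebra_simps add_divide_distrib)
  ultimately have d_\<eta>: "norm d \<le> D * \<eta>" by simp

  have K0: "0 \<le> \<eta> * K"
    using \<eta>0 spectral_norm_nonneg[of A] spectral_norm_nonneg[of "transpose A"]
    by (simp add: K_def)
  have "norm q \<le> (1 + norm x\<^sub>0 + K * D) * \<eta>\<^sup>2"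
    using q_le mult_left_mono[OF d_\<eta> K0] by (simp add: power2_eq_square algebra_simps)
  then have "norm q / \<alpha> \<le> (1 + norm x\<^sub>0 + K * D) / \<alpha> * \<eta>\<^sup>2"
    using \<alpha> by (simp add: divide_right_mono)
  then show ?thesis using d_lin by (simp add: d_def lin_def c_def)
qed

section \<open>First-order error bounds\<close>

theorem theorem3p3:
  fixes A :: "real^'n^'m" and xbar :: "real^'n" and bbar :: "real^'m"
    and \<alpha> :: real and xbar\<^sub>\<alpha> :: "real^'n"
    and xtilde :: "(real^'n^'m) \<times> (real^'m^'n) \<times> (real^'m) \<Rightarrow> real^'n"
  assumes "bbar = A *v xbar"
    and "\<alpha> > 0"
    and "xbar\<^sub>\<alpha> = matrix_inv (transpose A ** A + \<alpha> *\<^sub>R mat 1) *v (transpose A *v bbar)"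
    and "xtilde = (\<lambda>(E, F, e). unmatched_solution \<alpha> (A + E) (transpose A + F) (bbar + e))"
  shows "(\<forall>\<^sub>F (E, F, e) in small_pert. invertible (unmatched_matrix \<alpha> (A + E) (transpose A + F)))
    \<and> (\<lambda>(E, F, e). norm (xtilde (E, F, e) - xbar\<^sub>\<alpha>))
        \<lesssim> (\<lambda>(E, F, e). 1 / (2 * sqrt \<alpha>) * norm e
             + 1 / (2 * sqrt \<alpha>) * norm (E *v xbar\<^sub>\<alpha>)
             + 1 / \<alpha> * norm (F *v (bbar - A *v xbar\<^sub>\<alpha>)))
    \<and> (xbar\<^sub>\<alpha> \<noteq> 0 \<longrightarrow>
       (\<lambda>(E, F, e). norm (xtilde (E, F, e) - xbar\<^sub>\<alpha>) / norm xbar\<^sub>\<alpha>)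
        \<lesssim> (\<lambda>(E, F, e).
             spectral_norm A / (2 * sqrt \<alpha>) * (norm e / norm (A *v xbar\<^sub>\<alpha>))
             + spectral_norm A / (2 * sqrt \<alpha>) * (spectral_norm E / spectral_norm A)
             + (spectral_norm A)\<^sup>2 / \<alpha> * (spectral_norm F / spectral_norm A)
                 * (norm (bbar - A *v xbar\<^sub>\<alpha>) / norm (A *v xbar\<^sub>\<alpha>))))"
proof -
  define K where "K = spectral_norm A + spectral_norm (transpose A) + 1"
  define r where "r = bbar - A *v xbar\<^sub>\<alpha>"
  define C where "C = (1 + norm xbar\<^sub>\<alpha> + K * (2 * ((1 + norm xbar\<^sub>\<alpha>) / (2 * sqrt \<alpha>)
    + norm r / \<alpha> + (1 + norm xbar\<^sub>\<alpha>) / \<alpha>))) / \<alpha>"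
  (* Below this size the matrix changes by at most \<alpha> / 2 in norm. *)
  define \<delta> where "\<delta> = min 1 (\<alpha> / (2 * K))"
  have K: "K > 0"
    using spectral_norm_nonneg[of A] spectral_norm_nonneg[of "transpose A"] by (simp add: K_def)
  have \<delta>: "\<delta> > 0" using K assms(2) by (simp add: \<delta>_def)
  have small: "pert_size p \<le> 1" "pert_size p * K \<le> \<alpha> / 2"
    if "pert_size p < \<delta>" for p :: "(real^'n^'m) \<times> (real^'m^'n) \<times> (real^'m)"
    using that K by (simp_all add: \<delta>_def field_simps)
  have inv: "invertible (unmatched_matrix \<alpha> (A + E) (transpose A + F))"
    if "pert_size (E, F, e) < \<delta>" for E F and e :: "real^'m"
    using invertible_perturbed[OF assms(2), of E F e A] small[OF that] by (simp add: K_def)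
  have xbar\<^sub>\<alpha>: "unmatched_matrix \<alpha> A (transpose A) *v xbar\<^sub>\<alpha> = transpose A *v bbar"
    using matrix_inv_right[OF invertible_regularized[OF assms(2), of A]]
    unfolding assms(3) by (simp add: matrix_vector_mul_assoc unmatched_matrix_def)
  have err: "norm (xtilde (E, F, e) - xbar\<^sub>\<alpha>) \<le> 1 / (2 * sqrt \<alpha>) * norm e
      + 1 / (2 * sqrt \<alpha>) * norm (E *v xbar\<^sub>\<alpha>) + 1 / \<alpha> * norm (F *v r)
      + C * (pert_size (E, F, e))\<^sup>2"
    if "pert_size (E, F, e) < \<delta>" for E F e
    using perturbed_solution_error[OF assms(2) _ _ xbar\<^sub>\<alpha> unmatched_solution_eq[OF inv[OF that]]]
      small[OF that]
    by (simp add: assms(4) C_def r_def K_def)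
  show ?thesis unfolding r_def[symmetric]
  proof (intro conjI impI)
    show "\<forall>\<^sub>F (E, F, e) in small_pert. invertible (unmatched_matrix \<alpha> (A + E) (transpose A + F))"
      by (rule eventually_small_pertI[OF \<delta>]) (use inv in auto)
    show "(\<lambda>(E, F, e). norm (xtilde (E, F, e) - xbar\<^sub>\<alpha>)) \<lesssim>
      (\<lambda>(E, F, e). 1 / (2 * sqrt \<alpha>) * norm e + 1 / (2 * sqrt \<alpha>) * norm (E *v xbar\<^sub>\<alpha>)
        + 1 / \<alpha> * norm (F *v r))"
      by (rule first_order_leI[OF \<delta>, where C = C]) (use err in auto)
  next
    assume nz: "xbar\<^sub>\<alpha> \<noteq> 0"
    define a y n where "a = spectral_norm A" and "y = norm (A *v xbar\<^sub>\<alpha>)" and "n = norm xbar\<^sub>\<alpha>"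
    have n: "n > 0" using nz by (simp add: n_def)
    have y: "y > 0"
      using regularized_solution_in_kernel[OF assms(2) xbar\<^sub>\<alpha>] nz by (auto simp: y_def)
    have yan: "y \<le> a * n"
      unfolding y_def a_def n_def by (rule norm_matrix_vector_le_spectral_norm)
    have a: "a > 0" using y yan n by (meson less_le_trans zero_less_mult_pos2)
    (* Replaces the denominator n by y; this is where the extra factor a of the bound comes from. *)
    have inv_n: "1 / n \<le> a / y" using yan y n by (simp add: field_simps)
    show "(\<lambda>(E, F, e). norm (xtilde (E, F, e) - xbar\<^sub>\<alpha>) / norm xbar\<^sub>\<alpha>) \<lesssim>
      (\<lambda>(E, F, e). spectral_norm A / (2 * sqrt \<alpha>) * (norm e / norm (A *v xbar\<^sub>\<alpha>))
        + spectral_norm A / (2 * sqrt \<alpha>) * (spectral_norm E / spectral_norm A)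
        + (spectral_norm A)\<^sup>2 / \<alpha> * (spectral_norm F / spectral_norm A)
            * (norm r / norm (A *v xbar\<^sub>\<alpha>)))"
      unfolding a_def[symmetric] y_def[symmetric] n_def[symmetric]
    proof (rule first_order_leI[OF \<delta>, where C = "C / n"], clarify)
      fix E :: "real^'n^'m" and F :: "real^'m^'n" and e :: "real^'m"
      assume p: "pert_size (E, F, e) < \<delta>"
      define c where "c = 1 / (2 * sqrt \<alpha>)"
      have c: "0 \<le> c" using assms(2) by (simp add: c_def)
      have "norm (xtilde (E, F, e) - xbar\<^sub>\<alpha>) / n \<le> (c * norm e + c * norm (E *v xbar\<^sub>\<alpha>)
          + 1 / \<alpha> * norm (F *v r) + C * (pert_size (E, F, e))\<^sup>2) / n"
        using err[OF p] n unfolding c_def by (intro divide_right_mono) auto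
      also have "\<dots> = c * norm e * (1 / n) + c * (norm (E *v xbar\<^sub>\<alpha>) / n)
          + 1 / \<alpha> * norm (F *v r) * (1 / n) + C / n * (pert_size (E, F, e))\<^sup>2"
        by (simp add: add_divide_distrib)
      also have "\<dots> \<le> c * norm e * (a / y) + c * spectral_norm E
          + 1 / \<alpha> * (spectral_norm F * norm r) * (a / y) + C / n * (pert_size (E, F, e))\<^sup>2"
      proof (intro add_mono order_refl mult_mono inv_n)
        show "norm (E *v xbar\<^sub>\<alpha>) / n \<le> spectral_norm E"
          using norm_matrix_vector_le_spectral_norm[of E xbar\<^sub>\<alpha>] n
          by (simp add: n_def field_simps)
      qed (use c n y a assms(2) spectral_norm_nonneg[of F]
          in \<open>auto intro: norm_matrix_vector_le_spectral_norm\<close>)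
      also have "\<dots> = a / (2 * sqrt \<alpha>) * (norm e / y)
          + a / (2 * sqrt \<alpha>) * (spectral_norm E / a)
          + a\<^sup>2 / \<alpha> * (spectral_norm F / a) * (norm r / y) + C / n * (pert_size (E, F, e))\<^sup>2"
        using a by (simp add: c_def power2_eq_square mult_ac)
      finally show "norm (xtilde (E, F, e) - xbar\<^sub>\<alpha>) / n \<le> a / (2 * sqrt \<alpha>) * (norm e / y)
          + a / (2 * sqrt \<alpha>) * (spectral_norm E / a)
          + a\<^sup>2 / \<alpha> * (spectral_norm F / a) * (norm r / y)
          + C / n * (pert_size (E, F, e))\<^sup>2" .
    qed
  qed
qed

end
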